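(* Suppose $u$ and $v$ are two unimodal real sequences with mode intervals $[a,b]$ and $[c,d]$, respectively, where $a,b,c,d\in\mathbb{N}$, $a\le b$ and $c\le d$. If $a\le c\le b$ or $c=b+1$, then $u+v$ is unimodal.
   Context: Unimodal sequence: $u=(u_1,u_2,\dots)$ is unimodal with mode interval (interval of modes) $[a^-,a^+]$, a nonempty interval of positive integers, if $u_j\le u_{j+1}$ for $1\le j<a^-$, $u_j=u_{j+1}$ for $a^-\le j<a^+$, $u_j\ge u_{j+1}$ for $j\ge a^+$ (within the index range), and $u_{a^-}>\inf u$. Constant sequences are also regarded as unimodal. The two sequences share the same index set, and addition is termwise. *)

theory Defs
  imports "HOL-Library.Extended_Nat" "HOL-Library.Extended_Real"
begin

text \<open>A real sequence is a pair of its length \<open>N\<close>, possibly infinite, and a function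
  \<open>u :: nat \<Rightarrow> real\<close> of which only the values at the indices \<open>1, 2, \<dots>\<close> up to \<open>N\<close> matter.\<close>

definition indices :: "enat \<Rightarrow> nat set" where
  "indices N = {j. 1 \<le> j \<and> enat j \<le> N}"

text \<open>The infimum is taken in the extended reals, since an infinite sequence may be unbounded
  below. The interval \<open>[a, b]\<close> is not required to be maximal.\<close>

definition has_mode_interval :: "enat \<Rightarrow> (nat \<Rightarrow> real) \<Rightarrow> nat \<Rightarrow> nat \<Rightarrow> bool" where
  "has_mode_interval N u a b \<longleftrightarrow>
     a \<le> b \<and> {a..b} \<subseteq> indices N \<and>
     (\<forall>j. 1 \<le> j \<and> j < a \<longrightarrow> u j \<le> u (j + 1)) \<and>
     (\<forall>j. a \<le> j \<and> j < b \<longrightarrow> u j = u (j + 1)) \<and>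
     (\<forall>j. b \<le> j \<and> j + 1 \<in> indices N \<longrightarrow> u j \<ge> u (j + 1)) \<and>
     ereal (u a) > (INF j\<in>indices N. ereal (u j))"

definition unimodal :: "enat \<Rightarrow> (nat \<Rightarrow> real) \<Rightarrow> bool" where
  "unimodal N u \<longleftrightarrow>
     (\<exists>a b. has_mode_interval N u a b) \<or> (\<exists>k. \<forall>j\<in>indices N. u j = k)"

end

theory Submission
  imports Defs
begin

text \<open>A plateau counts as both rising and falling, so \<open>u\<close> rises up to
  \<open>b\<close> and falls from \<open>a\<close> on, while \<open>v\<close> rises up to
  \<open>c\<close> and falls from \<open>c\<close> on. If \<open>a \<le> c \<le> b\<close>, both
  rise before \<open>c\<close> and fall after it, so the sum peaks at \<open>c\<close>. If
  \<open>c = b + 1\<close>, they can disagree only on the single step from \<open>b\<close> to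
  \<open>c\<close>, and either sign of that step leaves a peak at \<open>b\<close> or
  \<open>c\<close>. By \<open>unimodal_if_peak\<close>, a weak peak suffices.\<close>

text \<open>The strict inequality with the infimum comes for free: a value different from
  \<open>w m\<close> must lie below the peak, and if there is none, the sequence is
  constant.\<close>

lemma unimodal_if_peak:
  fixes w :: "nat \<Rightarrow> real"
  assumes m: "m \<in> indices N"
    and up: "\<And>j. 1 \<le> j \<Longrightarrow> j < m \<Longrightarrow> w j \<le> w (j + 1)"
    and down: "\<And>j. m \<le> j \<Longrightarrow> j + 1 \<in> indices N \<Longrightarrow> w (j + 1) \<le> w j"
  shows "unimodal N w"
proof (cases "\<forall>j\<in>indices N. w j = w m")
  case True
  then show ?thesis
    unfolding unimodal_def by blast
next
  case False
  then obtain i where i: "i \<in> indices N" "w i \<noteq> w m"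
    by blast
  have "w i \<le> w m"
  proof (cases "i \<le> m")
    case True
    then show ?thesis
      using \<open>i \<in> indices N\<close>
    proof (induction i rule: inc_induct)
      case (step n)
      then have "Suc n \<in> indices N"
        using m by (auto simp: indices_def intro: order_trans[of "enat (Suc n)" "enat m"])
      with step up[of n] show ?case
        by (auto simp: indices_def)
    qed simp
  next
    case False
    then have "m \<le> i" by simp
    then show ?thesis
      using \<open>i \<in> indices N\<close>
    proof (induction i rule: dec_induct)
      case (step n)
      then have "n \<in> indices N"
        using m by (auto simp: indices_def intro: order_trans[of "enat n" "enat (Suc n)"])
      with step down[of n] show ?case
        by auto
    qed simp
  qed
  with i have "(INF j\<in>indices N. ereal (w j)) < ereal (w m)"
    unfolding INF_less_iff by (intro bexI[of _ i]) auto
  with m up down have "has_mode_interval N w m m"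
    unfolding has_mode_interval_def by simp
  then show ?thesis
    unfolding unimodal_def by blast
qed

theorem mainTheorem10:
  fixes N :: enat and u v :: "nat \<Rightarrow> real" and a b c d :: nat
  assumes "a \<le> b" and "c \<le> d"
    and "unimodal N u" and "has_mode_interval N u a b"
    and "unimodal N v" and "has_mode_interval N v c d"
    and "(a \<le> c \<and> c \<le> b) \<or> c = b + 1"
  shows "unimodal N (\<lambda>j. u j + v j)"
proof -
  have mem: "b \<in> indices N" "c \<in> indices N"
    using assms by (auto simp: has_mode_interval_def)
  \<comment> \<open>Equality on the plateau extends the rise of \<open>u\<close> from
    \<open>a\<close> to \<open>b\<close>, and likewise its fall back from \<open>b\<close> to
    \<open>a\<close>.\<close>
  have up_u: "u j \<le> u (j + 1)" if "1 \<le> j" "j < b" for j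
    using assms(4) that by (cases "j < a") (auto simp: has_mode_interval_def)
  have down_u: "u (j + 1) \<le> u j" if "a \<le> j" "j + 1 \<in> indices N" for j
    using assms(4) that by (cases "j < b") (auto simp: has_mode_interval_def)
  have up_v: "v j \<le> v (j + 1)" if "1 \<le> j" "j < c" for j
    using assms(6) that by (auto simp: has_mode_interval_def)
  have down_v: "v (j + 1) \<le> v j" if "c \<le> j" "j + 1 \<in> indices N" for j
    using assms(6) that by (cases "j < d") (auto simp: has_mode_interval_def)
  \<comment> \<open>If \<open>c = b + 1\<close>, the only step whose direction is unknown is the one from \<open>b\<close> to \<open>b + 1\<close>,
    so the peak is at one of its two ends.\<close>
  show ?thesis
  proof (cases "c = b + 1 \<and> u c + v c \<le> u b + v b")
    case True
    show ?thesis
    proof (rule unimodal_if_peak[OF mem(1)])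
      show "u j + v j \<le> u (j + 1) + v (j + 1)" if "1 \<le> j" "j < b" for j
        using up_u[of j] up_v[of j] True that by auto
      show "u (j + 1) + v (j + 1) \<le> u j + v j" if "b \<le> j" "j + 1 \<in> indices N" for j
        using down_u[of j] down_v[of j] True that assms(1) by (cases "j = b") auto
    qed
  next
    case False
    show ?thesis
    proof (rule unimodal_if_peak[OF mem(2)])
      \<comment> \<open>\<open>j = b\<close> is possible only if \<open>c = b + 1\<close>, and then
        the failed case condition says that the sum strictly rises from \<open>b\<close> to
        \<open>c\<close>.\<close>
      show "u j + v j \<le> u (j + 1) + v (j + 1)" if "1 \<le> j" "j < c" for j
        using up_u[of j] up_v[of j] False that assms(7) by (cases "j = b") auto
      show "u (j + 1) + v (j + 1) \<le> u j + v j" if "c \<le> j" "j + 1 \<in> indices N" for j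
        using down_u[of j] down_v[of j] that assms(1,7) by auto
    qed
  qed
qed

end
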